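(* Let $(A,\rightarrow,\rightsquigarrow,1)$ be a distributive pseudo-BE(A) algebra, let $s$ be a Bosbach state on $A$, and let $K=\mathrm{Ker}(s)=\{x\in A\mid s(x)=1\}$. Consider the quotient $A/K$ by the congruence $\Theta_K$. Then the operations induced on $A/K$ by $\rightarrow$ and by $\rightsquigarrow$ coincide, i.e. $(A/K,\rightarrow,1/K)=(A/K,\rightsquigarrow,1/K)$ (equivalently $(x\rightarrow y)/K=(x\rightsquigarrow y)/K$ for all $x,y\in A$), and $x/K\vee y/K=y/K\vee x/K$ for all $x,y\in A$, where $u\vee v=(u\rightarrow v)\rightarrow v$ in $A/K$.
   Context: A pseudo-BE algebra is an algebra $(A,\rightarrow,\rightsquigarrow,1)$ of type $(2,2,0)$ such that for all $x,y,z\in A$: $x\rightarrow x=x\rightsquigarrow x=1$; $x\rightarrow 1=x\rightsquigarrow 1=1$; $1\rightarrow x=1\rightsquigarrow x=x$; $x\rightarrow(y\rightsquigarrow z)=y\rightsquigarrow(x\rightarrow z)$; $x\rightarrow y=1$ iff $x\rightsquigarrow y=1$. Write $x\le y$ iff $x\rightarrow y=1$. It is a pseudo-BE(A) algebra if $x\le y$ implies $y\rightarrow z\le x\rightarrow z$ and $y\rightsquigarrow z\le x\rightsquigarrow z$ for all $z$. It is distributive if $x\rightarrow(y\rightsquigarrow z)=(x\rightarrow y)\rightsquigarrow(x\rightarrow z)$ for all $x,y,z$. A Bosbach state is a map $s:A\to[0,1]$ with $s(1)=1$, $s(x)+s(x\rightarrow y)=s(y)+s(y\rightarrow x)$ and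 $s(x)+s(x\rightsquigarrow y)=s(y)+s(y\rightsquigarrow x)$ for all $x,y$. A deductive system of $A$ is a set $D\subseteq A$ with $1\in D$ such that $x\in D$ and $x\rightarrow y\in D$ imply $y\in D$; $\mathrm{Ker}(s)$ is a deductive system. For a deductive system $H$ of a distributive pseudo-BE algebra, $\Theta_H$ is the congruence given by $(x,y)\in\Theta_H$ iff $x\rightarrow y\in H$ and $y\rightarrow x\in H$; $A/H$ is the quotient with classes $x/H$ and operations $x/H\rightarrow y/H=(x\rightarrow y)/H$, $x/H\rightsquigarrow y/H=(x\rightsquigarrow y)/H$, top $1/H$. *)

theory Defs
  imports Complex_Main
begin

locale pseudo_BE =
  fixes A :: "'a set"
    and imp :: "'a \<Rightarrow> 'a \<Rightarrow> 'a" (infixr "\<rightarrow>" 70)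
    and imp' :: "'a \<Rightarrow> 'a \<Rightarrow> 'a" (infixr "\<leadsto>" 70)
    and one :: 'a ("\<one>")
  assumes one_closed: "\<one> \<in> A"
    and imp_closed: "\<lbrakk>x \<in> A; y \<in> A\<rbrakk> \<Longrightarrow> x \<rightarrow> y \<in> A"
    and imp'_closed: "\<lbrakk>x \<in> A; y \<in> A\<rbrakk> \<Longrightarrow> x \<leadsto> y \<in> A"
    and imp_self: "x \<in> A \<Longrightarrow> x \<rightarrow> x = \<one>"
    and imp'_self: "x \<in> A \<Longrightarrow> x \<leadsto> x = \<one>"
    and imp_one: "x \<in> A \<Longrightarrow> x \<rightarrow> \<one> = \<one>"
    and imp'_one: "x \<in> A \<Longrightarrow> x \<leadsto> \<one> = \<one>"
    and one_imp: "x \<in> A \<Longrightarrow> \<one> \<rightarrow> x = x"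
    and one_imp': "x \<in> A \<Longrightarrow> \<one> \<leadsto> x = x"
    and exchange: "\<lbrakk>x \<in> A; y \<in> A; z \<in> A\<rbrakk> \<Longrightarrow> x \<rightarrow> (y \<leadsto> z) = y \<leadsto> (x \<rightarrow> z)"
    and imp_eq_one_iff: "\<lbrakk>x \<in> A; y \<in> A\<rbrakk> \<Longrightarrow> x \<rightarrow> y = \<one> \<longleftrightarrow> x \<leadsto> y = \<one>"

definition BE_le :: "('a \<Rightarrow> 'a \<Rightarrow> 'a) \<Rightarrow> 'a \<Rightarrow> 'a \<Rightarrow> 'a \<Rightarrow> bool" where
  "BE_le imp one x y \<longleftrightarrow> imp x y = one"

locale pseudo_BE_A = pseudo_BE +
  assumes imp_antimono:
      "\<lbrakk>x \<in> A; y \<in> A; z \<in> A; BE_le imp \<one> x y\<rbrakk> \<Longrightarrow> BE_le imp \<one> (y \<rightarrow> z) (x \<rightarrow> z)"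
    and imp'_antimono:
      "\<lbrakk>x \<in> A; y \<in> A; z \<in> A; BE_le imp \<one> x y\<rbrakk> \<Longrightarrow> BE_le imp \<one> (y \<leadsto> z) (x \<leadsto> z)"

locale distributive_pseudo_BE = pseudo_BE +
  assumes distrib:
    "\<lbrakk>x \<in> A; y \<in> A; z \<in> A\<rbrakk> \<Longrightarrow> x \<rightarrow> (y \<leadsto> z) = (x \<rightarrow> y) \<leadsto> (x \<rightarrow> z)"

locale distributive_pseudo_BE_A = distributive_pseudo_BE + pseudo_BE_A

definition bosbach_state ::
  "'a set \<Rightarrow> ('a \<Rightarrow> 'a \<Rightarrow> 'a) \<Rightarrow> ('a \<Rightarrow> 'a \<Rightarrow> 'a) \<Rightarrow> 'a \<Rightarrow> ('a \<Rightarrow> real) \<Rightarrow> bool" where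
  "bosbach_state A imp imp' one s \<longleftrightarrow>
     (\<forall>x\<in>A. s x \<in> {0..1}) \<and> s one = 1 \<and>
     (\<forall>x\<in>A. \<forall>y\<in>A. s x + s (imp x y) = s y + s (imp y x)) \<and>
     (\<forall>x\<in>A. \<forall>y\<in>A. s x + s (imp' x y) = s y + s (imp' y x))"

definition state_kernel :: "'a set \<Rightarrow> ('a \<Rightarrow> real) \<Rightarrow> 'a set" where
  "state_kernel A s = {x \<in> A. s x = 1}"

definition deductive_system :: "'a set \<Rightarrow> ('a \<Rightarrow> 'a \<Rightarrow> 'a) \<Rightarrow> 'a \<Rightarrow> 'a set \<Rightarrow> bool" where
  "deductive_system A imp one D \<longleftrightarrow>
     D \<subseteq> A \<and> one \<in> D \<and> (\<forall>x\<in>A. \<forall>y\<in>A. x \<in> D \<and> imp x y \<in> D \<longrightarrow> y \<in> D)"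

definition Theta :: "'a set \<Rightarrow> ('a \<Rightarrow> 'a \<Rightarrow> 'a) \<Rightarrow> 'a set \<Rightarrow> ('a \<times> 'a) set" where
  "Theta A imp H = {(x, y). x \<in> A \<and> y \<in> A \<and> imp x y \<in> H \<and> imp y x \<in> H}"

text \<open>The operation induced by \<open>f\<close> on the classes of \<open>R\<close>. If \<open>f\<close> respects \<open>R\<close>, all sets in the
  union are the same class, so this is the usual operation on representatives; see
  \<open>quot_op_imp\<close> and \<open>quot_op_imp'\<close> below.\<close>

definition quot_op :: "('a \<times> 'a) set \<Rightarrow> ('a \<Rightarrow> 'a \<Rightarrow> 'a) \<Rightarrow> 'a set \<Rightarrow> 'a set \<Rightarrow> 'a set" where
  "quot_op R f X Y = (\<Union>x\<in>X. \<Union>y\<in>Y. R `` {f x y})"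

definition BE_join :: "('b \<Rightarrow> 'b \<Rightarrow> 'b) \<Rightarrow> 'b \<Rightarrow> 'b \<Rightarrow> 'b" where
  "BE_join imp u v = imp (imp u v) v"

lemma deductive_system_state_kernel:
  assumes "pseudo_BE A imp imp' one" "bosbach_state A imp imp' one s"
  shows "deductive_system A imp one (state_kernel A s)"
proof -
  interpret pseudo_BE A imp imp' one by fact
  have "s y = 1" if "x \<in> A" "y \<in> A" "s x = 1" "s (imp x y) = 1" for x y
  proof -
    have "s x + s (imp x y) = s y + s (imp y x)" "s y \<le> 1" "s (imp y x) \<le> 1"
      using assms(2) that imp_closed by (auto simp: bosbach_state_def)
    with that show ?thesis by linarith
  qed
  moreover have "s one = 1"
    using assms(2) by (simp add: bosbach_state_def)
  ultimately show ?thesis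
    unfolding deductive_system_def state_kernel_def using one_closed by blast
qed

context distributive_pseudo_BE
begin

lemma one_trans:
  assumes A: "x \<in> A" "y \<in> A" "z \<in> A" and "x \<rightarrow> y = \<one>" "y \<rightarrow> z = \<one>"
  shows "x \<rightarrow> z = \<one>"
proof -
  have "y \<leadsto> z = \<one>"
    using imp_eq_one_iff[OF A(2,3)] assms(5) by simp
  then show ?thesis
    using distrib[OF A] assms(4) imp_one[OF A(1)] one_imp'[OF imp_closed[OF A(1,3)]] by simp
qed

lemma imp'_le_imp:
  assumes "x \<in> A" "y \<in> A"
  shows "(x \<leadsto> y) \<rightarrow> (x \<rightarrow> y) = \<one>"
proof -
  have "x \<rightarrow> (x \<leadsto> y) = x \<rightarrow> y"
    using distrib[of x x y] assms by (simp add: imp_self one_imp' imp_closed)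
  then have "x \<rightarrow> ((x \<leadsto> y) \<leadsto> y) = \<one>"
    using distrib[of x "x \<leadsto> y" y] assms by (simp add: imp'_self imp'_closed imp_closed)
  then have "(x \<leadsto> y) \<leadsto> (x \<rightarrow> y) = \<one>"
    using exchange[of x "x \<leadsto> y" y] assms by (simp add: imp'_closed)
  then show ?thesis
    using assms by (simp add: imp_eq_one_iff imp'_closed imp_closed)
qed

lemma imp_le_imp':
  assumes "x \<in> A" "y \<in> A"
  shows "(x \<rightarrow> y) \<rightarrow> (x \<leadsto> y) = \<one>"
proof -
  let ?a = "x \<rightarrow> y"
  have a: "?a \<in> A" using assms by (rule imp_closed)
  have "x \<rightarrow> (?a \<leadsto> y) = \<one>"
    using exchange[of x ?a y] assms a by (simp add: imp'_self)
  moreover have "(?a \<leadsto> y) \<rightarrow> (?a \<rightarrow> y) = \<one>"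
    using a assms by (intro imp'_le_imp)
  ultimately have "x \<rightarrow> (?a \<rightarrow> y) = \<one>"
    using a assms by (intro one_trans[of x "?a \<leadsto> y" "?a \<rightarrow> y"] imp_closed imp'_closed)
  then show ?thesis
    using exchange[of ?a x y] imp_eq_one_iff[of x "?a \<rightarrow> y"] a assms by (simp add: imp_closed)
qed

context
  fixes H
  assumes H: "deductive_system A imp \<one> H"
begin

lemma H_sub: "x \<in> H \<Longrightarrow> x \<in> A" and H_one: "\<one> \<in> H"
  and H_mp: "\<lbrakk>x \<in> H; x \<rightarrow> y \<in> H; y \<in> A\<rbrakk> \<Longrightarrow> y \<in> H"
  using H by (auto simp: deductive_system_def)

lemma H_iff:
  assumes "x \<in> A" "y \<in> A"
  shows "x \<leadsto> y \<in> H \<longleftrightarrow> x \<rightarrow> y \<in> H"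
proof -
  have "x \<rightarrow> y \<in> A" "x \<leadsto> y \<in> A"
    using assms by (auto intro: imp_closed imp'_closed)
  moreover have "(x \<rightarrow> y) \<rightarrow> (x \<leadsto> y) \<in> H" "(x \<leadsto> y) \<rightarrow> (x \<rightarrow> y) \<in> H"
    by (simp_all only: imp_le_imp'[OF assms] imp'_le_imp[OF assms] H_one)
  ultimately show ?thesis
    by (blast intro: H_mp)
qed

lemma le_imp:
  assumes "x \<in> A" "u \<in> A"
  shows "u \<rightarrow> (x \<rightarrow> u) = \<one>"
  using exchange[of x u u] imp_eq_one_iff[of u "x \<rightarrow> u"] assms
  by (simp add: imp'_self imp_one imp_closed)

lemma H_weaken: "\<lbrakk>x \<in> A; u \<in> H\<rbrakk> \<Longrightarrow> x \<rightarrow> u \<in> H"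
  by (rule H_mp[of u]) (simp_all add: le_imp H_sub H_one imp_closed)

lemma H_mono:
  assumes "x \<in> A" "y \<in> A" "z \<in> A" "x \<rightarrow> y \<in> H"
  shows "(z \<rightarrow> x) \<rightarrow> (z \<rightarrow> y) \<in> H"
proof -
  have "x \<leadsto> y \<in> H"
    using assms by (simp add: H_iff)
  then have "z \<rightarrow> (x \<leadsto> y) \<in> H"
    using assms(3) by (intro H_weaken)
  then have "(z \<rightarrow> x) \<leadsto> (z \<rightarrow> y) \<in> H"
    unfolding distrib[OF assms(3,1,2)] .
  then show ?thesis
    using assms by (simp add: H_iff imp_closed)
qed

lemma H_trans: "\<lbrakk>x \<in> A; y \<in> A; z \<in> A; x \<rightarrow> y \<in> H; y \<rightarrow> z \<in> H\<rbrakk> \<Longrightarrow> x \<rightarrow> z \<in> H"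
  by (rule H_mp[of "x \<rightarrow> y"]) (auto intro: H_mono imp_closed)

lemma H_antimono:
  assumes "x \<in> A" "y \<in> A" "z \<in> A" "x \<rightarrow> y \<in> H"
  shows "(y \<rightarrow> z) \<rightarrow> (x \<rightarrow> z) \<in> H"
proof -
  let ?b = "y \<leadsto> z" and ?c = "x \<rightarrow> z"
  have A: "?b \<in> A" "?c \<in> A" "x \<rightarrow> y \<in> A" "?b \<rightarrow> ?c \<in> A"
    using assms by (simp_all add: imp_closed imp'_closed)
  have "?b \<rightarrow> (x \<rightarrow> ?b) = \<one>"
    using A assms by (intro le_imp)
  then have "(x \<rightarrow> y) \<leadsto> (?b \<rightarrow> ?c) = \<one>"
    unfolding distrib[OF assms(1-3)] exchange[OF A(1,3,2)] .
  then have "(x \<rightarrow> y) \<rightarrow> (?b \<rightarrow> ?c) \<in> H"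
    using imp_eq_one_iff[OF A(3,4)] H_one by simp
  then have "?b \<rightarrow> ?c \<in> H"
    using A assms by (blast intro: H_mp)
  moreover have "(y \<rightarrow> z) \<rightarrow> (y \<leadsto> z) \<in> H"
    by (simp add: imp_le_imp' assms H_one)
  ultimately show ?thesis
    using A assms by (blast intro: H_trans imp_closed)
qed

lemma equiv_Theta: "equiv A (Theta A imp H)"
proof (rule equivI)
  show "Theta A imp H \<subseteq> A \<times> A" "sym (Theta A imp H)"
    by (auto simp: Theta_def sym_def)
  show "refl_on A (Theta A imp H)"
    by (auto simp: Theta_def refl_on_def imp_self H_one)
  show "trans (Theta A imp H)"
    by (rule transI) (auto simp: Theta_def intro: H_trans)
qed

lemma Theta_imp_imp': "\<lbrakk>x \<in> A; y \<in> A\<rbrakk> \<Longrightarrow> (x \<rightarrow> y, x \<leadsto> y) \<in> Theta A imp H"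
  by (simp add: Theta_def H_one imp_closed imp'_closed imp_le_imp' imp'_le_imp)

lemma congruent2_imp: "congruent2 (Theta A imp H) (Theta A imp H) (\<lambda>x y. Theta A imp H `` {x \<rightarrow> y})"
proof (rule congruent2I'[unfolded congruent_def])
  fix x x' y y' assume "(x, x') \<in> Theta A imp H" "(y, y') \<in> Theta A imp H"
  then have "(x \<rightarrow> y, x' \<rightarrow> y') \<in> Theta A imp H"
    unfolding Theta_def by (auto simp: imp_closed intro: H_trans[OF _ _ _ H_mono H_antimono])
  then show "Theta A imp H `` {x \<rightarrow> y} = Theta A imp H `` {x' \<rightarrow> y'}"
    by (rule equiv_class_eq[OF equiv_Theta])
qed

lemma quot_op_imp:
  assumes "x \<in> A" "y \<in> A"
  shows "quot_op (Theta A imp H) imp (Theta A imp H `` {x}) (Theta A imp H `` {y})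
           = Theta A imp H `` {x \<rightarrow> y}"
  unfolding quot_op_def
  by (rule UN_equiv_class2[OF equiv_Theta equiv_Theta congruent2_imp assms])

lemma quot_op_imp':
  assumes "x \<in> A" "y \<in> A"
  shows "quot_op (Theta A imp H) imp' (Theta A imp H `` {x}) (Theta A imp H `` {y})
           = Theta A imp H `` {x \<leadsto> y}"
proof -
  have eq: "Theta A imp H `` {u \<rightarrow> v} = Theta A imp H `` {u \<leadsto> v}" if "u \<in> A" "v \<in> A" for u v
    by (rule equiv_class_eq[OF equiv_Theta Theta_imp_imp'[OF that]])
  have "quot_op (Theta A imp H) imp' (Theta A imp H `` {x}) (Theta A imp H `` {y})
      = quot_op (Theta A imp H) imp (Theta A imp H `` {x}) (Theta A imp H `` {y})"
    unfolding quot_op_def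
    by (rule SUP_cong[OF refl])+ (rule eq[symmetric]; simp add: Theta_def)
  then show ?thesis by (simp add: quot_op_imp assms eq)
qed

end

end

end

theory Submission
  imports Defs
begin

text \<open>
  In a Bosbach state, \<open>u \<le> v\<close> gives \<open>s (v \<rightarrow> u) = s u + 1 - s v\<close>. Applied twice, this shows that
  \<open>(v \<rightarrow> u) \<rightarrow> u\<close> has the same state as \<open>v\<close>, hence that the two are congruent modulo the kernel.
  With \<open>Q = (y \<rightarrow> x) \<rightarrow> x\<close>, an upper bound of \<open>x\<close> and \<open>y\<close>, monotonicity of \<open>z \<mapsto> (z \<rightarrow> y) \<rightarrow> y\<close>
  yields \<open>(x \<rightarrow> y) \<rightarrow> y \<le> (Q \<rightarrow> y) \<rightarrow> y\<close>, and the right-hand side is congruent to \<open>Q\<close>.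
\<close>

context distributive_pseudo_BE
begin

lemma join_closed: "\<lbrakk>x \<in> A; y \<in> A\<rbrakk> \<Longrightarrow> BE_join imp x y \<in> A"
  by (simp add: BE_join_def imp_closed)

lemma le_imp_self: "\<lbrakk>x \<in> A; u \<in> A\<rbrakk> \<Longrightarrow> u \<rightarrow> (x \<rightarrow> u) = \<one>"
  \<comment> \<open>\<open>le_imp\<close> is stated relative to a deductive system; the whole of
    \<open>A\<close> serves as one.\<close>
  by (rule le_imp[of A]) (simp_all add: deductive_system_def one_closed)

lemma right_le_join: "\<lbrakk>x \<in> A; y \<in> A\<rbrakk> \<Longrightarrow> y \<rightarrow> BE_join imp x y = \<one>"
  unfolding BE_join_def by (simp add: le_imp_self imp_closed)

lemma left_le_join:
  assumes "x \<in> A" "y \<in> A"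
  shows "x \<rightarrow> BE_join imp x y = \<one>"
proof -
  have A: "x \<rightarrow> y \<in> A" using assms by (rule imp_closed)
  \<comment> \<open>Exchange bounds \<open>x\<close> by the mixed join only;
    \<open>imp'_le_imp\<close> then replaces its outer \<open>\<leadsto>\<close> by
    \<open>\<rightarrow>\<close>.\<close>
  have "x \<rightarrow> ((x \<rightarrow> y) \<leadsto> y) = \<one>"
    using exchange[OF assms(1) A assms(2)] A by (simp add: imp'_self)
  then show ?thesis
    unfolding BE_join_def
    using imp'_le_imp[OF A assms(2)] A assms
    by - (rule one_trans[of x "(x \<rightarrow> y) \<leadsto> y"], simp_all add: imp_closed imp'_closed)
qed

text \<open>Each of the two arrows into \<open>z\<close> reverses the order modulo \<open>H\<close>,
  so together they preserve it.\<close>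

lemma join_mono:
  assumes H: "deductive_system A imp \<one> H"
    and "x \<in> A" "y \<in> A" "z \<in> A" "x \<rightarrow> y \<in> H"
  shows "BE_join imp x z \<rightarrow> BE_join imp y z \<in> H"
  unfolding BE_join_def using assms by (simp add: H_antimono[OF H] imp_closed)

context
  fixes s
  assumes s: "bosbach_state A imp imp' \<one> s"
begin

lemma state_one: "s \<one> = 1"
  using s by (simp add: bosbach_state_def)

lemma state_exchange: "\<lbrakk>x \<in> A; y \<in> A\<rbrakk> \<Longrightarrow> s x + s (x \<rightarrow> y) = s y + s (y \<rightarrow> x)"
  using s by (simp add: bosbach_state_def)

lemma state_imp_of_le:
  assumes "u \<in> A" "v \<in> A" "u \<rightarrow> v = \<one>"
  shows "s (v \<rightarrow> u) = s u + 1 - s v"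
  using state_exchange[OF assms(1,2)] assms(3) state_one by simp

lemma join_imp_in_kernel:
  assumes A: "u \<in> A" "v \<in> A" and le: "u \<rightarrow> v = \<one>"
  shows "BE_join imp v u \<rightarrow> v \<in> state_kernel A s"
proof -
  let ?w = "v \<rightarrow> u" and ?j = "BE_join imp v u"
  have w: "?w \<in> A" using A by (simp add: imp_closed)
  have "s ?j = s u + 1 - s ?w"
    unfolding BE_join_def using state_imp_of_le[OF A(1) w le_imp_self[OF A(2,1)]] .
  then have "s ?j = s v"
    using state_imp_of_le[OF A le] by simp
  \<comment> \<open>Since \<open>v \<le> ?j\<close>, the state of \<open>?j \<rightarrow> v\<close>
    is \<open>s v + 1 - s ?j\<close>, and the two states agree.\<close>
  then have "s (?j \<rightarrow> v) = 1"
    using state_imp_of_le[OF A(2) join_closed[OF A(2,1)] left_le_join[OF A(2,1)]] by simp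
  then show ?thesis
    using A by (simp add: state_kernel_def imp_closed join_closed)
qed

lemma join_commute_le:
  assumes A: "x \<in> A" "y \<in> A"
  shows "BE_join imp x y \<rightarrow> BE_join imp y x \<in> state_kernel A s"
proof -
  let ?K = "state_kernel A s" and ?q = "BE_join imp y x"
  have K: "deductive_system A imp \<one> ?K"
    by (rule deductive_system_state_kernel[OF pseudo_BE_axioms s])
  have q: "?q \<in> A" using A by (simp add: join_closed)
  have "x \<rightarrow> ?q \<in> ?K"
    using A by (simp add: right_le_join H_one[OF K])
  then have "BE_join imp x y \<rightarrow> BE_join imp ?q y \<in> ?K"
    using A q by (intro join_mono[OF K])
  \<comment> \<open>This is the collapse for the pair \<open>y \<le> ?q\<close>.\<close>
  moreover have "BE_join imp ?q y \<rightarrow> ?q \<in> ?K"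
    using A q by (intro join_imp_in_kernel left_le_join)
  ultimately show ?thesis
    using A q by (blast intro: H_trans[OF K] join_closed)
qed

end

end

theorem theorem3p6:
  fixes A :: "'a set"
    and imp imp' :: "'a \<Rightarrow> 'a \<Rightarrow> 'a"
    and one :: 'a
    and s :: "'a \<Rightarrow> real"
    and K :: "'a set"
    and R :: "('a \<times> 'a) set"
  assumes "distributive_pseudo_BE_A A imp imp' one"
    and "bosbach_state A imp imp' one s"
    and "K = state_kernel A s"
    and "R = Theta A imp K"
  shows "(\<forall>X\<in>A // R. \<forall>Y\<in>A // R. quot_op R imp X Y = quot_op R imp' X Y)
       \<and> (\<forall>x\<in>A. \<forall>y\<in>A. R `` {imp x y} = R `` {imp' x y})
       \<and> (\<forall>x\<in>A. \<forall>y\<in>A. BE_join (quot_op R imp) (R `` {x}) (R `` {y})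
                        = BE_join (quot_op R imp) (R `` {y}) (R `` {x}))"
proof -
  interpret distributive_pseudo_BE_A A imp imp' one by fact
  have K: "deductive_system A imp one K"
    unfolding assms(3) by (rule deductive_system_state_kernel[OF pseudo_BE_axioms assms(2)])
  note equiv = equiv_Theta[OF K, folded assms(4)]
    and op = quot_op_imp[OF K, folded assms(4)] and op' = quot_op_imp'[OF K, folded assms(4)]
  \<comment> \<open>Each of the two arrows lies below the other in \<open>A\<close>, so they are
    congruent.\<close>
  have eq: "R `` {imp x y} = R `` {imp' x y}" if "x \<in> A" "y \<in> A" for x y
    unfolding assms(4) by (rule equiv_class_eq[OF equiv_Theta[OF K] Theta_imp_imp'[OF K that]])
  have "quot_op R imp X Y = quot_op R imp' X Y" if "X \<in> A // R" "Y \<in> A // R" for X Y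
    using that by (auto elim!: quotientE simp: op op' eq)
  moreover have "BE_join (quot_op R imp) (R `` {x}) (R `` {y})
      = BE_join (quot_op R imp) (R `` {y}) (R `` {x})" if "x \<in> A" "y \<in> A" for x y
  proof -
    have join: "BE_join (quot_op R imp) (R `` {u}) (R `` {v}) = R `` {BE_join imp u v}"
      if "u \<in> A" "v \<in> A" for u v
      using that by (simp add: BE_join_def op imp_closed)
    \<comment> \<open>\<open>join_commute_le\<close>, used for \<open>x\<close>, \<open>y\<close>
      and again with the two swapped, gives both halves of the congruence.\<close>
    have "(BE_join imp x y, BE_join imp y x) \<in> R"
      unfolding assms(3,4) Theta_def
      using that by (simp add: join_closed join_commute_le[OF assms(2)])
    then have "R `` {BE_join imp x y} = R `` {BE_join imp y x}"
      by (rule equiv_class_eq[OF equiv])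
    then show ?thesis
      using that by (simp add: join)
  qed
  ultimately show ?thesis
    using eq by blast
qed

end
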